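(* There is a $\preceq_c$ and $\preceq^i_c$-descending chain $\big((\mathbb{K},\mathbb{G}_p)\big)_{p\in\omega}$, that is, for each $p\in\omega$, $(\mathbb{K},\mathbb{G}_{p+1})\preceq^i_c(\mathbb{K},\mathbb{G}_p)$ (hence also $\preceq_c$) and $(\mathbb{K},\mathbb{G}_p)\not\preceq_c(\mathbb{K},\mathbb{G}_{p+1})$ (hence also $\not\preceq^i_c$), such that (a) $\mathbb{K}$ is a 0DMC space; (b) for each $p$, $\mathbb{G}_p$ is a countable $D_2(\mathbf{\Pi}^0_1)$ graph on $\mathbb{K}$ with CCN three and $\mathbf{\Sigma}^0_1\oplus\mathbf{\Pi}^0_1$ chromatic number two, whose vertices have degree at most one.
   Context: A space is 0DMC if it is zero-dimensional (has a basis of clopen sets), metrizable and compact. A digraph on $X$ is a binary relation $R\subseteq X^2$ disjoint from the diagonal; a graph is a symmetric digraph. A coloring of $R$ is a map $c$ on $X$ with $c(x)\neq c(y)$ whenever $(x,y)\in R$. The continuous chromatic number (CCN) $\chi_c(X,R)$ is the least cardinal $\kappa\leq\aleph_0$ for which there is a continuous coloring $c:X\to\kappa$ ($\kappa$ discrete) if it exists, and $2^{\aleph_0}$ otherwise. $(X,R)\preceq_c(Y,S)$ means that there is a continuous $\varphi:X\to Y$ with $R\subseteq(\varphi\times\varphi)^{-1}(S)$; $(X,R)\preceq^i_c(Y,S)$ means that moreover $\varphi$ can be chosen injective. $D_2(\mathbf{\Pi}^0_1)$ is the class of differences of two closed sets (here subsets of $\mathbb{K}^2$). $\mathbf{\Sigma}^0_1\oplus\mathbf{\Pi}^0_1$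 is the class of sets of the form $(O\cap C)\cup(F\setminus C)$ with $C$ clopen, $O$ open, $F$ closed. A graph $(X,G)$ has $\mathbf{\Sigma}^0_1\oplus\mathbf{\Pi}^0_1$ chromatic number two if there is a set $A\subseteq X$ in $\mathbf{\Sigma}^0_1\oplus\mathbf{\Pi}^0_1$ with $G\cap(A^2\cup(X\setminus A)^2)=\emptyset$, and $G\neq\emptyset$. The degree of a vertex is the number of its neighbours. *)

theory Defs
  imports "HOL-Analysis.Analysis" "HOL-Library.Extended_Nat"
begin

section \<open>Spaces and pointclasses\<close>

definition zero_dimensional_space :: "'a topology \<Rightarrow> bool" where
  "zero_dimensional_space X \<longleftrightarrow>
     (\<exists>\<B>. (\<forall>U\<in>\<B>. openin X U \<and> closedin X U) \<and> openin X = arbitrary union_of (\<lambda>U. U \<in> \<B>))"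

definition zero_dmc :: "'a topology \<Rightarrow> bool" where
  "zero_dmc X \<longleftrightarrow> zero_dimensional_space X \<and> metrizable_space X \<and> compact_space X"

definition D2_Pi01 :: "'a topology \<Rightarrow> 'a set \<Rightarrow> bool" where
  "D2_Pi01 X D \<longleftrightarrow> (\<exists>A B. closedin X A \<and> closedin X B \<and> D = A - B)"

definition Sigma01_oplus_Pi01 :: "'a topology \<Rightarrow> 'a set \<Rightarrow> bool" where
  "Sigma01_oplus_Pi01 X A \<longleftrightarrow>
     (\<exists>C U F. openin X C \<and> closedin X C \<and> openin X U \<and> closedin X F \<and> A = (U \<inter> C) \<union> (F - C))"

section \<open>Digraphs, graphs and colorings\<close>

definition digraph_on :: "'a set \<Rightarrow> 'a rel \<Rightarrow> bool" where
  "digraph_on V R \<longleftrightarrow> R \<subseteq> V \<times> V \<and> irrefl R"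

definition graph_on :: "'a set \<Rightarrow> 'a rel \<Rightarrow> bool" where
  "graph_on V G \<longleftrightarrow> digraph_on V G \<and> sym G"

definition coloring :: "'a rel \<Rightarrow> ('a \<Rightarrow> 'b) \<Rightarrow> bool" where
  "coloring R c \<longleftrightarrow> (\<forall>(x, y)\<in>R. c x \<noteq> c y)"

text \<open>The cardinals up to \<open>\<aleph>\<^sub>0\<close> are encoded by \<^typ>\<open>enat\<close>, with \<open>\<infinity>\<close> standing for \<open>\<aleph>\<^sub>0\<close>; the
  cardinal \<open>k\<close> is represented, as a set of colors, by the natural numbers below \<open>k\<close>.\<close>

definition continuously_colorable :: "'a topology \<Rightarrow> 'a rel \<Rightarrow> enat \<Rightarrow> bool" where
  "continuously_colorable X R k \<longleftrightarrow>
     (\<exists>c :: 'a \<Rightarrow> nat. continuous_map X (discrete_topology {i. enat i < k}) c \<and> coloring R c)"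

datatype ccn_value = Countable_CCN enat | Continuum_CCN

definition ccn :: "'a topology \<Rightarrow> 'a rel \<Rightarrow> ccn_value" where
  "ccn X R =
     (if \<exists>k. continuously_colorable X R k
      then Countable_CCN (LEAST k. continuously_colorable X R k)
      else Continuum_CCN)"

definition Sigma01_oplus_Pi01_chromatic_number_two :: "'a topology \<Rightarrow> 'a rel \<Rightarrow> bool" where
  "Sigma01_oplus_Pi01_chromatic_number_two X G \<longleftrightarrow>
     (\<exists>A\<subseteq>topspace X. Sigma01_oplus_Pi01 X A \<and>
        G \<inter> (A \<times> A \<union> (topspace X - A) \<times> (topspace X - A)) = {}) \<and>
     G \<noteq> {}"

text \<open>Valued in \<^typ>\<open>enat\<close> because \<^const>\<open>card\<close> is 0 on infinite sets.\<close>

definition vertex_degree :: "'a rel \<Rightarrow> 'a \<Rightarrow> enat" where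
  "vertex_degree G x = (if finite (G `` {x}) then enat (card (G `` {x})) else \<infinity>)"

section \<open>Reducibility\<close>

definition cont_reducible :: "'a topology \<times> 'a rel \<Rightarrow> 'b topology \<times> 'b rel \<Rightarrow> bool"
    (infix \<open>\<preceq>\<^sub>c\<close> 50) where
  "XR \<preceq>\<^sub>c YS \<longleftrightarrow>
     (\<exists>\<phi>. continuous_map (fst XR) (fst YS) \<phi> \<and> snd XR \<subseteq> map_prod \<phi> \<phi> -` snd YS)"

definition inj_cont_reducible :: "'a topology \<times> 'a rel \<Rightarrow> 'b topology \<times> 'b rel \<Rightarrow> bool"
    (infix \<open>\<preceq>\<^sup>i\<^sub>c\<close> 50) where
  "XR \<preceq>\<^sup>i\<^sub>c YS \<longleftrightarrow>
     (\<exists>\<phi>. continuous_map (fst XR) (fst YS) \<phi> \<and> inj_on \<phi> (topspace (fst XR)) \<and>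
          snd XR \<subseteq> map_prod \<phi> \<phi> -` snd YS)"

definition descending_chain :: "('a \<Rightarrow> 'a \<Rightarrow> bool) \<Rightarrow> (nat \<Rightarrow> 'a) \<Rightarrow> bool" where
  "descending_chain le s \<longleftrightarrow> (\<forall>p. le (s (Suc p)) (s p) \<and> \<not> le (s p) (s (Suc p)))"

text \<open>A compact metrizable space has at most continuum many points, so up to homeomorphism every
  0DMC space is a topology on a subset of the type \<^typ>\<open>nat \<Rightarrow> bool\<close>. Existence of a 0DMC space is
  therefore stated as existence of some \<open>K :: (nat \<Rightarrow> bool) topology\<close>, where \<open>K\<close> is not required to
  carry the topology of Cantor space.\<close>

end

theory Submission
  imports Defs "HOL-Number_Theory.Cong"
begin

text \<open>
  The space is the ring of 3-adic integers together with countably many isolated points that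
  accumulate at it: for naturals \<open>a\<close> and \<open>b\<close> there is one isolated point close to \<open>a\<close> and one
  close to \<open>b\<close>, and these two form the only possible edge at either of them. The graph
  \<open>\<G>\<^sub>p\<close> keeps the edges with \<open>b \<equiv> a + 1\<close> modulo \<open>3\<^bsup>p+1\<^esup>\<close>. It is a countable matching of
  isolated points, so it is open in its closure, and the points on the \<open>a\<close>-side form an open
  2-coloring. The graphs decrease with \<open>p\<close>, so the identity is an injective reduction of each of them
  to the preceding one.

  Continuous maps into discrete spaces, however, only see the closure of \<open>\<G>\<^sub>p\<close>. As the edges given by
  \<open>(a + 3\<^sup>k, b + 3\<^sup>k)\<close> converge to \<open>(a, b)\<close>, this closure relates all 3-adic integers that differ by
  one modulo \<open>3\<^bsup>p+1\<^esup>\<close>, and it contains the odd cycle \<open>0, 1, \<dots>, 3\<^bsup>p+1\<^esup> - 1, 0\<close>. Hence two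
  colors do not suffice, whereas the residue modulo 3 is a continuous 3-coloring. The same cycle
  separates consecutive graphs. Along the edges of \<open>\<G>\<^bsub>p+1\<^esub>\<close> the residue modulo \<open>3\<^bsup>p+2\<^esup>\<close>
  changes by one up or down. A reduction of \<open>\<G>\<^sub>p\<close> to \<open>\<G>\<^bsub>p+1\<^esub>\<close> would thus yield a sum of
  \<open>3\<^bsup>p+1\<^esup>\<close> signs that is divisible by \<open>3\<^bsup>p+2\<^esup>\<close>; such a sum is odd, hence nonzero, and
  it is too small. Both uses of the cycle are instances of \<open>no_unit_step_map\<close>.
\<close>

section \<open>Sums of signs around an odd cycle\<close>

definition unit_step :: "int \<Rightarrow> nat \<Rightarrow> nat \<Rightarrow> bool" where
  "unit_step m x y \<longleftrightarrow> m dvd int y - int x - 1 \<or> m dvd int y - int x + 1"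

lemma unit_step_sym: "unit_step m x y \<Longrightarrow> unit_step m y x"
  using dvd_minus_iff[of m "int y - int x - 1"] dvd_minus_iff[of m "int y - int x + 1"]
  unfolding unit_step_def by (simp add: algebra_simps) argo

lemma unit_step_walk:
  assumes "\<And>i. unit_step m (h i) (h (Suc i))"
  shows "\<exists>s. \<bar>s\<bar> \<le> int n \<and> even (s - int n) \<and> m dvd int (h n) - int (h 0) - s"
proof (induction n)
  case 0
  show ?case by (intro exI[of _ 0]) simp
next
  case (Suc n)
  then obtain s where s: "\<bar>s\<bar> \<le> int n" "even (s - int n)" "m dvd int (h n) - int (h 0) - s"
    by blast
  from assms[of n] consider "m dvd int (h (Suc n)) - int (h n) - 1"
    | "m dvd int (h (Suc n)) - int (h n) + 1"
    unfolding unit_step_def by blast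
  then show ?case
  proof cases
    case 1
    have "m dvd int (h (Suc n)) - int (h 0) - (s + 1)"
      using dvd_add[OF s(3) 1] by (simp add: algebra_simps)
    with s(1,2) show ?thesis by (intro exI[of _ "s + 1"]) auto
  next
    case 2
    have "m dvd int (h (Suc n)) - int (h 0) - (s - 1)"
      using dvd_add[OF s(3) 2] by (simp add: algebra_simps)
    with s(1,2) show ?thesis by (intro exI[of _ "s - 1"]) auto
  qed
qed

text \<open>
  The total change around the cycle is zero, and modulo \<open>m\<close> it is a sum of \<open>L\<close> signs. This sum is
  odd and at most \<open>L\<close> in absolute value, so no even number and no number above \<open>L\<close> divides it.
\<close>

lemma no_unit_step_odd_cycle:
  assumes step: "\<And>i. unit_step m (h i) (h (Suc i))" and closed: "h L = h 0"
    and "odd L" and m: "even m \<or> int L < m"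
  shows False
proof -
  obtain s where s: "\<bar>s\<bar> \<le> int L" "even (s - int L)" "m dvd int (h L) - int (h 0) - s"
    using unit_step_walk[of m h L] step by blast
  have "odd s" using s(2) \<open>odd L\<close> by simp
  have "m dvd s" using s(3) closed by simp
  show False
    using m
  proof
    assume "even m"
    with \<open>m dvd s\<close> \<open>odd s\<close> show False by (meson dvd_trans)
  next
    assume "int L < m"
    with s(1) \<open>m dvd s\<close> \<open>odd s\<close> show False
      using dvd_imp_le_int[of s m] by (cases "s = 0") auto
  qed
qed

section \<open>Closed subspaces of the Cantor space\<close>

definition cantor :: "(nat \<Rightarrow> bool) topology" where
  "cantor = product_topology (\<lambda>_. discrete_topology UNIV) UNIV"

lemma topspace_cantor [simp]: "topspace cantor = UNIV"
  by (simp add: cantor_def)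

lemma continuous_map_cantor_coordinate:
  "continuous_map cantor (discrete_topology UNIV) (\<lambda>z. z j)"
  unfolding cantor_def by (rule continuous_map_product_projection) simp

lemma cantor_neighbourhood_clopen:
  assumes "openin cantor U" "z \<in> U"
  obtains W where "openin cantor W" "closedin cantor W" "z \<in> W" "W \<subseteq> U"
proof -
  obtain B where B: "finite {i. B i \<noteq> (UNIV :: bool set)}" "z \<in> Pi\<^sub>E UNIV B" "Pi\<^sub>E UNIV B \<subseteq> U"
    using assms unfolding cantor_def openin_product_topology_alt by auto
  have "openin cantor (Pi\<^sub>E UNIV B)" "closedin cantor (Pi\<^sub>E UNIV B)"
    using B(1) unfolding cantor_def by (auto simp: openin_PiE_gen closedin_product_topology)
  with B that show ?thesis by blast
qed

lemma zero_dmc_closed_subspace_cantor: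
  assumes "closedin cantor S"
  shows "zero_dmc (subtopology cantor S)"
proof -
  let ?K = "subtopology cantor S"
  have "compact_space cantor"
    unfolding cantor_def by (simp add: compact_space_product_topology compact_space_discrete_topology)
  then have compact: "compact_space ?K"
    using assms closedin_compact_space compact_space_subtopology by blast
  have "metrizable_space cantor"
    unfolding cantor_def by (simp add: metrizable_space_product_topology metrizable_space_discrete_topology)
  then have metrizable: "metrizable_space ?K"
    by (rule metrizable_space_subtopology)
  let ?clopen = "{W. openin ?K W \<and> closedin ?K W}"
  have "openin ?K U \<longleftrightarrow> (arbitrary union_of (\<lambda>W. W \<in> ?clopen)) U" for U
  proof
    assume "openin ?K U"
    then obtain T where T: "openin cantor T" "U = T \<inter> S"
      by (auto simp: openin_subtopology)
    have "\<exists>W. W \<in> ?clopen \<and> z \<in> W \<and> W \<subseteq> U" if "z \<in> U" for z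
    proof -
      have "z \<in> T" using that T(2) by simp
      then obtain W where W: "openin cantor W" "closedin cantor W" "z \<in> W" "W \<subseteq> T"
        by (rule cantor_neighbourhood_clopen[OF T(1)])
      have "openin ?K (W \<inter> S)" "closedin ?K (W \<inter> S)"
        unfolding openin_subtopology closedin_subtopology using W(1,2) by blast+
      moreover have "z \<in> W \<inter> S" "W \<inter> S \<subseteq> U"
        using that T(2) W(3,4) by auto
      ultimately show ?thesis by blast
    qed
    then show "(arbitrary union_of (\<lambda>W. W \<in> ?clopen)) U"
      by (simp add: arbitrary_union_of_alt)
  next
    assume "(arbitrary union_of (\<lambda>W. W \<in> ?clopen)) U"
    then show "openin ?K U"
      unfolding union_of_def arbitrary_def by auto
  qed
  then have "openin ?K = arbitrary union_of (\<lambda>W. W \<in> ?clopen)"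
    by (rule ext)
  moreover have "\<forall>W\<in>?clopen. openin ?K W \<and> closedin ?K W"
    by simp
  ultimately have "zero_dimensional_space ?K"
    unfolding zero_dimensional_space_def by (intro exI[of _ ?clopen] conjI)
  with compact metrizable show ?thesis by (simp add: zero_dmc_def)
qed

section \<open>The 3-adic integers with isolated points attached\<close>

text \<open>
  The vertices \<open>(a, b, False)\<close> and \<open>(a, b, True)\<close> are the two ends of the edge indexed by
  \<open>a\<close> and \<open>b\<close>; the former end lies close to \<open>a\<close> and the latter to \<open>b\<close>.
\<close>

type_synonym vertex = "nat \<times> nat \<times> bool"

text \<open>
  A point is coded by its residues modulo all powers of 3 together with the test, for each vertex, of
  being that vertex. Thus \<open>point r None\<close> is the natural number \<open>r\<close> as a 3-adic integer, and
  \<open>point r (Some v)\<close> is an isolated point with the same residues.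
\<close>

definition point :: "nat \<Rightarrow> vertex option \<Rightarrow> nat \<Rightarrow> bool" where
  "point r V = (\<lambda>j. case (from_nat j :: vertex + nat \<times> nat) of
     Inl u \<Rightarrow> V = Some u | Inr (k, i) \<Rightarrow> r mod 3 ^ k = i)"

definition vertex_coord :: "vertex \<Rightarrow> nat" where
  "vertex_coord u = to_nat (Inl u :: vertex + nat \<times> nat)"

definition residue_coord :: "nat \<Rightarrow> nat \<Rightarrow> nat" where
  "residue_coord k i = to_nat (Inr (k, i) :: vertex + nat \<times> nat)"

lemma point_vertex_coord [simp]: "point r V (vertex_coord u) \<longleftrightarrow> V = Some u"
  by (simp add: point_def vertex_coord_def)

lemma point_residue_coord [simp]: "point r V (residue_coord k i) \<longleftrightarrow> r mod 3 ^ k = i"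
  by (simp add: point_def residue_coord_def)

fun approx :: "vertex \<Rightarrow> nat" where
  "approx (a, b, s) = (if s then b else a)"

definition isolated :: "vertex \<Rightarrow> nat \<Rightarrow> bool" where
  "isolated v = point (approx v) (Some v)"

lemma isolated_vertex_coord [simp]: "isolated v (vertex_coord u) \<longleftrightarrow> v = u"
  by (simp add: isolated_def)

lemma isolated_residue_coord [simp]: "isolated v (residue_coord k i) \<longleftrightarrow> approx v mod 3 ^ k = i"
  by (simp add: isolated_def)

lemma isolated_eq_iff [simp]: "isolated u = isolated v \<longleftrightarrow> u = v"
  by (metis isolated_vertex_coord)

definition K_set :: "(nat \<Rightarrow> bool) set" where
  "K_set = cantor closure_of (range isolated)"

definition K_space :: "(nat \<Rightarrow> bool) topology" where
  "K_space = subtopology cantor K_set"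

lemma topspace_K [simp]: "topspace K_space = K_set"
  by (simp add: K_space_def)

lemma zero_dmc_K: "zero_dmc K_space"
  unfolding K_space_def K_set_def by (rule zero_dmc_closed_subspace_cantor) simp

lemma isolated_in_K [simp]: "isolated v \<in> K_set"
  unfolding K_set_def using closure_of_subset[of "range isolated" cantor] by auto

lemma openin_K_coordinate: "openin K_space {z \<in> K_set. z j}"
proof -
  have "openin K_space {z \<in> topspace K_space. z j \<in> {True}}"
    unfolding K_space_def
    by (rule openin_continuous_map_preimage)
       (auto intro: continuous_map_from_subtopology continuous_map_cantor_coordinate)
  then show ?thesis by simp
qed

text \<open>
  Any property of finitely many coordinates that all isolated points have holds on the whole
  space.
\<close>

lemma isolated_agrees_on_finite:
  assumes "z \<in> K_set" "finite J"
  obtains v where "\<And>j. j \<in> J \<Longrightarrow> isolated v j = z j"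
proof -
  let ?U = "\<Inter>j\<in>J. {y. y j \<in> {z j}}"
  have "openin cantor {y. y j \<in> {z j}}" for j
    using openin_continuous_map_preimage[OF continuous_map_cantor_coordinate, of "{z j}" j] by simp
  then have "openin cantor (\<Inter>j\<in>J. {y. y j \<in> {z j}})"
    using openin_INT[OF assms(2), of cantor "\<lambda>j. {y. y j \<in> {z j}}"] by simp
  moreover have "z \<in> ?U" by simp
  ultimately obtain v where "isolated v \<in> ?U"
    using assms(1) unfolding K_set_def in_closure_of by blast
  then show ?thesis by (intro that) auto
qed

lemma openin_K_isolated: "openin K_space {isolated v}"
proof -
  have "z = isolated v" if z: "z \<in> K_set" "z (vertex_coord v)" for z
  proof
    fix j
    obtain u where u: "\<And>i. i \<in> {vertex_coord v, j} \<Longrightarrow> isolated u i = z i"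
      using isolated_agrees_on_finite[OF z(1), of "{vertex_coord v, j}"] by auto
    then have "u = v" using z(2) by (metis insertI1 isolated_vertex_coord)
    with u show "z j = isolated v j" by simp
  qed
  then have "{z \<in> K_set. z (vertex_coord v)} = {isolated v}" by auto
  with openin_K_coordinate show ?thesis by metis
qed

lemma openin_K_isolated_image: "openin K_space (isolated ` A)"
proof -
  have "isolated ` A = (\<Union>v\<in>A. {isolated v})" by auto
  then show ?thesis using openin_K_isolated by (auto intro!: openin_Union)
qed

definition residue :: "nat \<Rightarrow> (nat \<Rightarrow> bool) \<Rightarrow> nat" where
  "residue k z = (LEAST i. z (residue_coord k i))"

lemma residue_isolated [simp]: "residue k (isolated v) = approx v mod 3 ^ k"
  unfolding residue_def by (rule Least_equality) auto

lemma residue_eq_iff: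
  assumes "z \<in> K_set"
  shows "residue k z = i \<and> i < 3 ^ k \<longleftrightarrow> z (residue_coord k i)"
    and "residue k z < 3 ^ k"
proof -
  \<comment> \<open>On these finitely many coordinates \<open>z\<close> looks like a vertex, which has a well-defined residue.\<close>
  obtain v where v: "\<And>j. j \<in> residue_coord k ` insert i {..<3 ^ k} \<Longrightarrow> isolated v j = z j"
    using isolated_agrees_on_finite[OF assms, of "residue_coord k ` insert i {..<3 ^ k}"] by auto
  have *: "z (residue_coord k l) \<longleftrightarrow> approx v mod 3 ^ k = l" if "l < 3 ^ k \<or> l = i" for l
    using v[of "residue_coord k l"] that by auto
  have "residue k z = approx v mod 3 ^ k"
    unfolding residue_def
  proof (rule Least_equality)
    show "z (residue_coord k (approx v mod 3 ^ k))" by (simp add: *)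
    fix l assume "z (residue_coord k l)"
    have "approx v mod 3 ^ k < 3 ^ k" by simp
    with *[of l] \<open>z (residue_coord k l)\<close> show "approx v mod 3 ^ k \<le> l"
      by linarith
  qed
  then show "residue k z = i \<and> i < 3 ^ k \<longleftrightarrow> z (residue_coord k i)" "residue k z < 3 ^ k"
    using *[of i] by auto
qed

lemma continuous_map_residue: "continuous_map K_space (discrete_topology {..<3 ^ k}) (residue k)"
  unfolding continuous_map
proof (intro conjI allI impI)
  show "residue k ` topspace K_space \<subseteq> topspace (discrete_topology {..<3 ^ k})"
    using residue_eq_iff(2) by auto
  fix U :: "nat set"
  assume "openin (discrete_topology {..<3 ^ k}) U"
  then have "U \<subseteq> {..<3 ^ k}" by simp
  then have "{z \<in> topspace K_space. residue k z \<in> U} =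
      (\<Union>i\<in>U. {z \<in> K_set. z (residue_coord k i)})"
    by (auto simp: subset_iff simp flip: residue_eq_iff(1))
  moreover have "openin K_space \<dots>"
    by (intro openin_Union) (auto simp: openin_K_coordinate)
  ultimately show "openin K_space {z \<in> topspace K_space. residue k z \<in> U}" by simp
qed

lemma limitin_cantor_if_coordinates_stabilize:
  assumes "\<And>j. eventually (\<lambda>n. f n j = z j) F"
  shows "limitin cantor f z F"
  unfolding cantor_def limitin_componentwise
proof (intro conjI ballI)
  fix j
  show "limitin (discrete_topology UNIV) (\<lambda>n. f n j) (z j) F"
    using assms[of j] unfolding limitin_def by (auto elim: eventually_mono)
qed auto

text \<open>
  The shift by powers of 3 leaves every residue eventually fixed while it leaves every vertex behind.
\<close>

lemma limitin_K_isolated_shift: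
  "limitin K_space (\<lambda>n. isolated (a + 3 ^ n, b + 3 ^ n, s)) (point (if s then b else a) None) sequentially"
    (is "limitin _ ?f ?z _")
proof -
  let ?r = "if s then b else a"
  have "eventually (\<lambda>n. ?f n j = ?z j) sequentially" for j
  proof (cases "from_nat j :: vertex + nat \<times> nat")
    case (Inl u)
    have "(a + 3 ^ n, b + 3 ^ n, s) \<noteq> u" if "n \<ge> fst u" for n
    proof -
      have "n < 3 ^ n" by (rule power_gt_expt) simp
      with that show ?thesis by auto
    qed
    then show ?thesis
      using Inl by (auto simp: isolated_def point_def eventually_sequentially)
  next
    case (Inr q)
    obtain k i where q: "q = (k, i)" by fastforce
    have "(?r + 3 ^ n) mod 3 ^ k = ?r mod 3 ^ k" if "n \<ge> k" for n
    proof -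
      have "(3 ^ n :: nat) mod 3 ^ k = 0" using le_imp_power_dvd[OF that, of "3 :: nat"] by simp
      then show ?thesis using mod_add_right_eq[of ?r "3 ^ n" "3 ^ k"] by simp
    qed
    then show ?thesis
      using Inr q unfolding eventually_sequentially
      by (auto simp: isolated_def point_def intro!: exI[of _ k])
  qed
  then have lim: "limitin cantor ?f ?z sequentially"
    by (rule limitin_cantor_if_coordinates_stabilize)
  have "?z \<in> K_set"
    by (rule limitin_closedin[OF lim _ always_eventually])
      (use isolated_in_K in \<open>auto simp: K_set_def simp del: isolated_in_K\<close>)
  with lim show ?thesis
    unfolding K_space_def limitin_subtopology by simp
qed

text \<open>
  This is how a locally constant map sees the closure of a set of edges: a relation that it satisfies
  on the edges near \<open>(a, b)\<close> passes to the limit pair.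
\<close>

lemma locally_constant_limit_edge:
  assumes f: "continuous_map K_space (discrete_topology D) f"
    and edges: "\<And>n. Q (f (isolated (a + 3 ^ n, b + 3 ^ n, False))) (f (isolated (a + 3 ^ n, b + 3 ^ n, True)))"
  shows "Q (f (point a None)) (f (point b None))"
proof -
  have "eventually (\<lambda>n. f (isolated (a + 3 ^ n, b + 3 ^ n, s)) = f (point (if s then b else a) None))
      sequentially" for s
  proof -
    have "limitin (discrete_topology D) (f \<circ> (\<lambda>n. isolated (a + 3 ^ n, b + 3 ^ n, s)))
        (f (point (if s then b else a) None)) sequentially"
      by (rule continuous_map_limit[OF f limitin_K_isolated_shift])
    then show ?thesis
      unfolding limitin_def by (auto dest!: spec[of _ "{f (point (if s then b else a) None)}"])
  qed
  from this[of False] this[of True]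
  have "eventually (\<lambda>n :: nat. Q (f (point a None)) (f (point b None))) sequentially"
    by eventually_elim (use edges in \<open>metis (full_types)\<close>)
  then show ?thesis by simp
qed

section \<open>The graphs\<close>

definition matching_graph :: "nat \<Rightarrow> (nat \<Rightarrow> bool) rel" where
  "matching_graph p = {(isolated (a, b, s), isolated (a, b, \<not> s)) | a b s. [b = a + 1] (mod 3 ^ Suc p)}"

lemma matching_graphI:
  "[b = a + 1] (mod 3 ^ Suc p) \<Longrightarrow> (isolated (a, b, s), isolated (a, b, \<not> s)) \<in> matching_graph p"
  unfolding matching_graph_def by blast

lemma matching_graph_cases:
  assumes "(x, y) \<in> matching_graph p"
  obtains a b s where "x = isolated (a, b, s)" "y = isolated (a, b, \<not> s)" "[b = a + 1] (mod 3 ^ Suc p)"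
  using assms unfolding matching_graph_def by blast

lemma matching_graph_antimono:
  assumes "p \<le> q"
  shows "matching_graph q \<subseteq> matching_graph p"
proof -
  have "(3 :: nat) ^ Suc p dvd 3 ^ Suc q"
    using assms by (intro le_imp_power_dvd) simp
  then show ?thesis
    unfolding matching_graph_def by (blast intro: cong_dvd_modulus_nat)
qed

lemma graph_on_matching_graph: "graph_on K_set (matching_graph p)"
proof -
  have "matching_graph p \<subseteq> K_set \<times> K_set"
    unfolding matching_graph_def by auto
  moreover have "irrefl (matching_graph p)"
    unfolding matching_graph_def irrefl_def by auto
  moreover have "sym (matching_graph p)"
  proof (rule symI)
    fix x y
    assume "(x, y) \<in> matching_graph p"
    then obtain a b s where "x = isolated (a, b, s)" "y = isolated (a, b, \<not> s)" "[b = a + 1] (mod 3 ^ Suc p)"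
      by (rule matching_graph_cases)
    then show "(y, x) \<in> matching_graph p"
      using matching_graphI[of b a p "\<not> s"] by simp
  qed
  ultimately show ?thesis by (simp add: graph_on_def digraph_on_def)
qed

lemma matching_graph_subset_isolated: "matching_graph p \<subseteq> range isolated \<times> range isolated"
  unfolding matching_graph_def by auto

lemma countable_matching_graph: "countable (matching_graph p)"
  by (rule countable_subset[OF matching_graph_subset_isolated]) simp

lemma vertex_degree_matching_graph: "vertex_degree (matching_graph p) x \<le> 1"
proof -
  have "y = y'" if "(x, y) \<in> matching_graph p" "(x, y') \<in> matching_graph p" for y y'
    using that unfolding matching_graph_def by auto
  then obtain y where "matching_graph p `` {x} \<subseteq> {y}" by blast
  then have "finite (matching_graph p `` {x})" "card (matching_graph p `` {x}) \<le> 1"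
    using finite_subset card_mono[of "{y}"] by fastforce+
  then show ?thesis by (simp add: vertex_degree_def one_enat_def)
qed

text \<open>
  Pairs of isolated points are isolated in the square, and they form an open set. Hence the graph is
  what remains of its closure after removing the complement of this open set.
\<close>

lemma D2_Pi01_matching_graph: "D2_Pi01 (prod_topology K_space K_space) (matching_graph p)"
proof -
  let ?P = "prod_topology K_space K_space"
  let ?B = "topspace ?P - range isolated \<times> range isolated"
  have G: "matching_graph p \<subseteq> topspace ?P"
    using graph_on_matching_graph by (auto simp: graph_on_def digraph_on_def)
  have "(isolated u, isolated v) \<in> matching_graph p"
    if uv: "(isolated u, isolated v) \<in> ?P closure_of matching_graph p" for u v
  proof -
    have "openin ?P ({isolated u} \<times> {isolated v})"
      by (intro openin_prod_Times_iff[THEN iffD2] disjI2 conjI openin_K_isolated)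
    with uv have "\<exists>w. w \<in> matching_graph p \<and> w \<in> {isolated u} \<times> {isolated v}"
      unfolding in_closure_of by (elim conjE allE[of _ "{isolated u} \<times> {isolated v}"]) simp
    then show ?thesis by auto
  qed
  then have "?P closure_of matching_graph p \<inter> range isolated \<times> range isolated \<subseteq> matching_graph p"
    by auto
  then have "matching_graph p = ?P closure_of matching_graph p - ?B"
    using closure_of_subset[OF G] closure_of_subset_topspace[of ?P "matching_graph p"]
      matching_graph_subset_isolated[of p] by blast
  moreover have "closedin ?P ?B"
    by (intro openin_closedin_eq[THEN iffD1, THEN conjunct2] openin_prod_Times_iff[THEN iffD2]
        disjI2 conjI openin_K_isolated_image)
  ultimately show ?thesis
    unfolding D2_Pi01_def using closedin_closure_of by blast
qed

lemma matching_graph_chromatic_number_two: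
  "Sigma01_oplus_Pi01_chromatic_number_two K_space (matching_graph p)"
proof -
  let ?A = "isolated ` {v. snd (snd v)}"
  have "?A = ?A \<inter> topspace K_space \<union> ({} - topspace K_space)" by auto
  then have "Sigma01_oplus_Pi01 K_space ?A"
    unfolding Sigma01_oplus_Pi01_def
    by (intro exI conjI)
      (rule openin_topspace closedin_topspace openin_K_isolated_image closedin_empty | assumption)+
  moreover have "matching_graph p \<inter> (?A \<times> ?A \<union> (K_set - ?A) \<times> (K_set - ?A)) = {}"
  proof -
    have "isolated v \<in> ?A \<longleftrightarrow> snd (snd v)" for v by (simp add: image_iff)
    then show ?thesis by (force elim!: matching_graph_cases)
  qed
  moreover have "(isolated (0, 1, False), isolated (0, 1, True)) \<in> matching_graph p"
    using matching_graphI[of 1 0 p False] by simp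
  ultimately show ?thesis
    unfolding Sigma01_oplus_Pi01_chromatic_number_two_def by (intro conjI exI[of _ ?A]) auto
qed

lemma residue_unit_step:
  assumes "(x, y) \<in> matching_graph p" "k \<le> Suc p"
  shows "unit_step (3 ^ k) (residue k x) (residue k y)"
proof -
  obtain a b s where xy: "x = isolated (a, b, s)" "y = isolated (a, b, \<not> s)" "[b = a + 1] (mod 3 ^ Suc p)"
    using assms(1) by (rule matching_graph_cases)
  have "[b = a + 1] (mod 3 ^ k)"
    using xy(3) assms(2) cong_dvd_modulus_nat le_imp_power_dvd by blast
  then have "[int b = int a + 1] (mod 3 ^ k)"
    using cong_int_iff[of b "a + 1" "3 ^ k"] by (simp add: add.commute)
  then have "[int (b mod 3 ^ k) = int (a mod 3 ^ k) + 1] (mod 3 ^ k)"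
    by (simp add: cong_def zmod_int mod_simps)
  then have "unit_step (3 ^ k) (a mod 3 ^ k) (b mod 3 ^ k)"
    unfolding unit_step_def cong_iff_dvd_diff by (simp add: algebra_simps)
  with xy(1,2) show ?thesis
    by (cases s) (auto intro: unit_step_sym)
qed

text \<open>
  The closure of the graph contains the cycle through the residues modulo \<open>3\<^bsup>p+1\<^esup>\<close>, which has
  odd length.
\<close>

lemma no_unit_step_map:
  assumes f: "continuous_map K_space (discrete_topology D) f"
    and step: "\<And>x y. (x, y) \<in> matching_graph p \<Longrightarrow> unit_step m (f x) (f y)"
    and m: "even m \<or> 3 ^ Suc p < m"
  shows False
proof -
  let ?L = "3 ^ Suc p :: nat"
  let ?h = "\<lambda>i. f (point (i mod ?L) None)"
  have "unit_step m (f (point a None)) (f (point b None))" if "[b = a + 1] (mod ?L)" for a b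
  proof (rule locally_constant_limit_edge[where Q = "unit_step m", OF f])
    fix n
    have "[b + 3 ^ n = (a + 3 ^ n) + 1] (mod ?L)"
      using cong_add[OF that cong_refl[of "3 ^ n"]] by (simp only: ac_simps)
    then have "(isolated (a + 3 ^ n, b + 3 ^ n, False), isolated (a + 3 ^ n, b + 3 ^ n, True))
        \<in> matching_graph p"
      using matching_graphI[where s = False] by (simp only: not_False_eq_True)
    then show "unit_step m (f (isolated (a + 3 ^ n, b + 3 ^ n, False)))
        (f (isolated (a + 3 ^ n, b + 3 ^ n, True)))"
      by (rule step)
  qed
  then have "unit_step m (?h i) (?h (Suc i))" for i
    by (simp add: cong_def mod_Suc_eq del: power_Suc)
  moreover have "?h ?L = ?h 0" by simp
  ultimately show False
    using m by (intro no_unit_step_odd_cycle[of m ?h ?L]) auto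
qed

lemma ccn_matching_graph: "ccn K_space (matching_graph p) = Countable_CCN 3"
proof -
  have "coloring (matching_graph p) (residue 1)"
    unfolding coloring_def
  proof clarify
    fix x y
    assume "(x, y) \<in> matching_graph p" "residue 1 x = residue 1 y"
    with residue_unit_step[of x y p 1] show False by (simp add: unit_step_def)
  qed
  moreover have "{..<3 ^ 1} = {i :: nat. enat i < 3}"
    by (auto simp: numeral_eq_enat)
  ultimately have three: "continuously_colorable K_space (matching_graph p) 3"
    unfolding continuously_colorable_def using continuous_map_residue[of 1] by metis
  have "3 \<le> k" if "continuously_colorable K_space (matching_graph p) k" for k
  proof (rule ccontr)
    assume "\<not> 3 \<le> k"
    then have two: "i < 2" if "enat i < k" for i
      using that by (cases k) (auto simp: numeral_eq_enat)
    obtain c where c: "continuous_map K_space (discrete_topology {i. enat i < k}) c"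
        "coloring (matching_graph p) c"
      using \<open>continuously_colorable _ _ k\<close> unfolding continuously_colorable_def by blast
    have lt: "c z < 2" if "z \<in> K_set" for z
      using continuous_map_image_subset_topspace[OF c(1)] that two by fastforce
    \<comment> \<open>Two distinct colors below 2 differ by one modulo 2.\<close>
    have "unit_step 2 (c x) (c y)" if "(x, y) \<in> matching_graph p" for x y
    proof -
      have "c x \<noteq> c y" using c(2) that by (auto simp: coloring_def)
      moreover have "x \<in> K_set" "y \<in> K_set"
        using that matching_graph_subset_isolated by fastforce+
      ultimately have "c x = 0 \<and> c y = 1 \<or> c x = 1 \<and> c y = 0"
        using lt[of x] lt[of y] by linarith
      then show ?thesis by (auto simp: unit_step_def)
    qed
    then show False using no_unit_step_map[OF c(1), of p 2] by auto
  qed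
  with three have "(LEAST k. continuously_colorable K_space (matching_graph p) k) = 3"
    by (intro Least_equality) auto
  with three show ?thesis unfolding ccn_def by auto
qed

lemma matching_graph_not_reducible:
  "\<not> (K_space, matching_graph p) \<preceq>\<^sub>c (K_space, matching_graph (Suc p))"
proof
  assume "(K_space, matching_graph p) \<preceq>\<^sub>c (K_space, matching_graph (Suc p))"
  then obtain \<phi> where \<phi>: "continuous_map K_space K_space \<phi>"
      "matching_graph p \<subseteq> map_prod \<phi> \<phi> -` matching_graph (Suc p)"
    unfolding cont_reducible_def by auto
  let ?k = "Suc (Suc p)"
  have "continuous_map K_space (discrete_topology {..<3 ^ ?k}) (residue ?k \<circ> \<phi>)"
    using \<phi>(1) continuous_map_residue by (rule continuous_map_compose)
  moreover have "unit_step (3 ^ ?k) ((residue ?k \<circ> \<phi>) x) ((residue ?k \<circ> \<phi>) y)"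
    if "(x, y) \<in> matching_graph p" for x y
    using residue_unit_step[of "\<phi> x" "\<phi> y" "Suc p" ?k] that \<phi>(2) by auto
  moreover have "even (3 ^ ?k :: int) \<or> 3 ^ Suc p < (3 ^ ?k :: int)"
    by simp
  ultimately show False
    by (rule no_unit_step_map)
qed

lemma matching_graph_inj_reducible:
  "(K_space, matching_graph (Suc p)) \<preceq>\<^sup>i\<^sub>c (K_space, matching_graph p)"
proof -
  have "matching_graph (Suc p) \<subseteq> map_prod id id -` matching_graph p"
    using matching_graph_antimono[of p "Suc p"] by (simp add: map_prod.id)
  then show ?thesis
    unfolding inj_cont_reducible_def fst_conv snd_conv
    by (intro exI[of _ id] conjI continuous_map_id inj_on_id)
qed

theorem theorem1p6:
  shows "\<exists>(K :: (nat \<Rightarrow> bool) topology) (G :: nat \<Rightarrow> (nat \<Rightarrow> bool) rel).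
    descending_chain (\<preceq>\<^sub>c) (\<lambda>p. (K, G p)) \<and>
    descending_chain (\<preceq>\<^sup>i\<^sub>c) (\<lambda>p. (K, G p)) \<and>
    zero_dmc K \<and>
    (\<forall>p. graph_on (topspace K) (G p) \<and>
         countable (G p) \<and>
         D2_Pi01 (prod_topology K K) (G p) \<and>
         ccn K (G p) = Countable_CCN 3 \<and>
         Sigma01_oplus_Pi01_chromatic_number_two K (G p) \<and>
         (\<forall>x\<in>topspace K. vertex_degree (G p) x \<le> 1))"
proof -
  have weaken: "XR \<preceq>\<^sub>c YS" if "XR \<preceq>\<^sup>i\<^sub>c YS"
    for XR YS :: "(nat \<Rightarrow> bool) topology \<times> (nat \<Rightarrow> bool) rel"
    using that unfolding inj_cont_reducible_def cont_reducible_def by blast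
  have "descending_chain (\<preceq>\<^sub>c) (\<lambda>p. (K_space, matching_graph p))"
    "descending_chain (\<preceq>\<^sup>i\<^sub>c) (\<lambda>p. (K_space, matching_graph p))"
    unfolding descending_chain_def
    using weaken matching_graph_inj_reducible matching_graph_not_reducible by blast+
  then show ?thesis
    using zero_dmc_K graph_on_matching_graph countable_matching_graph D2_Pi01_matching_graph
      ccn_matching_graph matching_graph_chromatic_number_two vertex_degree_matching_graph
    by (intro exI[of _ K_space] exI[of _ matching_graph]) simp
qed

end
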